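(* Let $(\Omega,m)$ be a measure space with a positive (not necessarily finite) measure $m$, and let $p,q\in(1,\infty)$ satisfy $\frac1p+\frac1q=1$. Let $\rho\ge 0$ be a probability density on $\Omega$ with respect to $m$, i.e. $\int_\Omega \rho\,dm=1$, such that $\int_\Omega \rho^p\,dm<\infty$. Then $$S_p\{\rho\}=\frac{p}{1-p}\,\log\Bigl[\sup_{\rho'\in B_q}\langle \rho,\rho'\rangle\Bigr],\qquad B_q=\bigl\{g\in L_q(\Omega,dm):\ \|g\|_{L_q(\Omega,dm)}=1\bigr\},$$ and equivalently, in terms of entropies only, $$S_p\{\rho\}=\frac{p}{1-p}\,\log\Bigl[\sup_{\rho'\in L_q(\Omega,dm),\ S_q(\rho')=0}\langle \rho,\rho'\rangle\Bigr].$$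
   Context: All functions are real-valued. For $r>1$ and a nonzero function $f\in L_r(\Omega,dm)$ (not necessarily a probability density), the Rényi entropy of index $r$ is $$S_r(f)=S_r\{f\}=\frac{1}{1-r}\log\Bigl[\int_\Omega |f(\mathbf{x})|^r\,dm(\mathbf{x})\Bigr]=\frac{r}{1-r}\log\|f\|_{L_r(\Omega,dm)},$$ where $\log$ is the natural logarithm. For $f\in L_p(\Omega,dm)$ and $g\in L_q(\Omega,dm)$ with $\frac1p+\frac1q=1$, the pairing is $\langle f,g\rangle=\int_\Omega f(\mathbf{x})g(\mathbf{x})\,dm(\mathbf{x})$. *)

theory Defs
  imports "HOL-Analysis.Analysis"
begin

text \<open>Elements of \<open>L\<^sub>r\<close> are represented by functions rather than by classes of functions modulo
  equality almost everywhere.\<close>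

definition Lr_space :: "real \<Rightarrow> 'a measure \<Rightarrow> ('a \<Rightarrow> real) set" where
  "Lr_space r M = {f \<in> borel_measurable M. integrable M (\<lambda>x. \<bar>f x\<bar> powr r)}"

definition Lr_norm :: "real \<Rightarrow> 'a measure \<Rightarrow> ('a \<Rightarrow> real) \<Rightarrow> real" where
  "Lr_norm r M f = (\<integral>x. \<bar>f x\<bar> powr r \<partial>M) powr (1 / r)"

text \<open>Only meaningful for \<open>f \<in> Lr_space r M\<close> that is not zero almost everywhere: for the zero
  function, \<^term>\<open>ln (0::real) = 0\<close> would give entropy \<open>0\<close>.\<close>

definition renyi_entropy :: "real \<Rightarrow> 'a measure \<Rightarrow> ('a \<Rightarrow> real) \<Rightarrow> real" where
  "renyi_entropy r M f = 1 / (1 - r) * ln (\<integral>x. \<bar>f x\<bar> powr r \<partial>M)"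

lemma renyi_entropy_eq_norm:
  assumes "r > 1"
  shows "renyi_entropy r M f = r / (1 - r) * ln (Lr_norm r M f)"
  using assms by (simp add: renyi_entropy_def Lr_norm_def ln_powr)

definition pairing :: "'a measure \<Rightarrow> ('a \<Rightarrow> real) \<Rightarrow> ('a \<Rightarrow> real) \<Rightarrow> real" where
  "pairing M f g = (\<integral>x. f x * g x \<partial>M)"

definition Lr_unit_sphere :: "real \<Rightarrow> 'a measure \<Rightarrow> ('a \<Rightarrow> real) set" where
  "Lr_unit_sphere r M = {g \<in> Lr_space r M. Lr_norm r M g = 1}"

text \<open>The zero function has no Renyi entropy, so it is excluded explicitly.\<close>

definition zero_entropy_set :: "real \<Rightarrow> 'a measure \<Rightarrow> ('a \<Rightarrow> real) set" where
  "zero_entropy_set r M =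
     {g \<in> Lr_space r M. \<not> (AE x in M. g x = 0) \<and> renyi_entropy r M g = 0}"

text \<open>Suprema are taken in the extended reals, where an empty or unbounded family has the supremum
  \<open>-\<infinity>\<close> or \<open>\<infinity>\<close> instead of an unspecified real number. The logarithm takes infinite values outside
  the positive reals, so that an equation between \<open>c * ereal_ln s\<close> with \<open>c \<noteq> 0\<close> and a real
  number can hold only if \<open>s\<close> is a positive real number.\<close>

definition ereal_ln :: "ereal \<Rightarrow> ereal" where
  "ereal_ln s = (if s \<le> 0 then -\<infinity> else if s = \<infinity> then \<infinity> else ereal (ln (real_of_ereal s)))"

end

(*
  The duality between L_p and L_q: Hoelder's inequality, obtained by integrating Young's inequality
  for the normalised functions, bounds the pairing on the unit sphere of L_q by the L_p norm N of f,
  and the bound is attained at sgn f * (|f| / N) powr (p - 1). The functions of zero entropy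
  of index q are exactly those of L_q norm 1.
*)
theory Submission
  imports Defs
begin

lemma Lr_norm_pos_iff:
  assumes "f \<in> Lr_space r M"
  shows "0 < Lr_norm r M f \<longleftrightarrow> \<not> (AE x in M. f x = 0)"
proof -
  have "integral\<^sup>L M (\<lambda>x. \<bar>f x\<bar> powr r) = 0 \<longleftrightarrow> (AE x in M. \<bar>f x\<bar> powr r = 0)"
    using assms by (intro integral_nonneg_eq_0_iff_AE) (auto simp: Lr_space_def)
  then show ?thesis
    by (simp add: Lr_norm_def)
qed

text \<open>The entropy is the nonzero factor \<open>r / (1 - r)\<close> times the logarithm of the
  norm, and on the positive reals \<open>ln\<close> vanishes only at 1.\<close>

lemma zero_entropy_set_eq_Lr_unit_sphere:
  assumes "1 < r"
  shows "zero_entropy_set r M = Lr_unit_sphere r M"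
proof -
  have "\<not> (AE x in M. g x = 0) \<and> renyi_entropy r M g = 0 \<longleftrightarrow> Lr_norm r M g = 1"
    if "g \<in> Lr_space r M" for g
  proof (cases "0 < Lr_norm r M g")
    case True
    then show ?thesis
      using assms Lr_norm_pos_iff[OF that] by (simp add: renyi_entropy_eq_norm)
  next
    \<comment> \<open>Norm 0: the convention \<open>ln 0 = 0\<close> gives entropy 0, but g vanishes
      almost everywhere and is thus excluded from the left side; its norm is not 1 either.\<close>
    case False
    then show ?thesis
      using Lr_norm_pos_iff[OF that] by auto
  qed
  then show ?thesis
    by (auto simp: zero_entropy_set_def Lr_unit_sphere_def)
qed

lemma Lr_norm_powr:
  assumes "0 < r"
  shows "Lr_norm r M f powr r = (\<integral>x. \<bar>f x\<bar> powr r \<partial>M)"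
  using assms by (simp add: Lr_norm_def powr_powr)

lemma pairing_le_Lr_norm:
  assumes "1 < p" and "1 < q" and pq: "1 / p + 1 / q = 1"
    and f: "f \<in> Lr_space p M" and N: "0 < Lr_norm p M f"
    and g: "g \<in> Lr_unit_sphere q M"
  shows "pairing M f g \<le> Lr_norm p M f"
proof -
  define N where "N = Lr_norm p M f"
  have "0 < N"
    using N by (simp add: N_def)
  \<comment> \<open>N times the Young bound for \<open>\<bar>f x\<bar> / N\<close> and
    \<open>\<bar>g x\<bar>\<close>. Dividing by N makes both powers integrate to 1, so that h
    integrates to \<open>N * (1 / p + 1 / q) = N\<close>.\<close>
  define h where "h x = N * (\<bar>f x\<bar> powr p / N powr p / p + \<bar>g x\<bar> powr q / q)" for x
  have int: "integrable M (\<lambda>x. \<bar>f x\<bar> powr p)" "integrable M (\<lambda>x. \<bar>g x\<bar> powr q)"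
    using f g by (auto simp: Lr_space_def Lr_unit_sphere_def)
  have "(\<integral>x. \<bar>g x\<bar> powr q \<partial>M) = 1"
    using g Lr_norm_powr[of q M g] \<open>1 < q\<close> by (simp add: Lr_unit_sphere_def)
  moreover have "(\<integral>x. \<bar>f x\<bar> powr p \<partial>M) = N powr p"
    using Lr_norm_powr[of p M f] \<open>1 < p\<close> by (simp add: N_def)
  ultimately have "(\<integral>x. h x \<partial>M) = N * (1 / p + 1 / q)"
    unfolding h_def using int \<open>0 < N\<close> by simp
  then have h_eq: "(\<integral>x. h x \<partial>M) = N"
    using pq by simp
  have "f x * g x \<le> h x" for x
  proof -
    have "f x * g x \<le> N * (\<bar>f x\<bar> / N * \<bar>g x\<bar>)"
      using abs_ge_self[of "f x * g x"] \<open>0 < N\<close> by (simp add: abs_mult)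
    also have "\<bar>f x\<bar> / N * \<bar>g x\<bar> \<le> (\<bar>f x\<bar> / N) powr p / p + \<bar>g x\<bar> powr q / q"
      using assms(1-3) \<open>0 < N\<close> by (intro Youngs_inequality) auto
    finally show ?thesis
      using \<open>0 < N\<close> by (simp add: h_def powr_divide)
  qed
  moreover have "integrable M h"
    unfolding h_def using int by simp
  \<comment> \<open>With h nonnegative, \<open>integral_mono'\<close> asks only h to be integrable:
    a non-integrable product would have the default integral 0, which is still below that of
    h.\<close>
  moreover have "0 \<le> h x" for x
    using assms(1,2) \<open>0 < N\<close> by (simp add: h_def)
  ultimately have "pairing M f g \<le> (\<integral>x. h x \<partial>M)"
    unfolding pairing_def by (intro integral_mono') auto
  with h_eq show ?thesis
    by (simp add: N_def)
qed

lemma Lr_norm_pairing_attained: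
  assumes "1 < p" and "1 < q" and pq: "1 / p + 1 / q = 1"
    and f: "f \<in> Lr_space p M" and N: "0 < Lr_norm p M f"
  obtains g where "g \<in> Lr_unit_sphere q M" and "pairing M f g = Lr_norm p M f"
proof
  define N where "N = Lr_norm p M f"
  have "0 < N"
    using N by (simp add: N_def)
  \<comment> \<open>Equality in Young's inequality requires
    \<open>\<bar>g x\<bar> powr q = (\<bar>f x\<bar> / N) powr p\<close>; since
    \<open>(p - 1) * q = p\<close>, this fixes the modulus of g. The sign makes the product with f
    nonnegative.\<close>
  define g where "g x = sgn (f x) * (\<bar>f x\<bar> / N) powr (p - 1)" for x
  have [measurable]: "f \<in> borel_measurable M"
    using f by (simp add: Lr_space_def)
  have int: "integrable M (\<lambda>x. \<bar>f x\<bar> powr p)"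
    using f by (simp add: Lr_space_def)
  have I: "(\<integral>x. \<bar>f x\<bar> powr p \<partial>M) = N powr p"
    using Lr_norm_powr[of p M f] \<open>1 < p\<close> by (simp add: N_def)
  have exponent: "(p - 1) * q = p"
    using pq assms(1,2) by (simp add: field_simps)
  have g_powr: "\<bar>g x\<bar> powr q = \<bar>f x\<bar> powr p / N powr p" for x
    using \<open>0 < N\<close> exponent
    by (cases "f x = 0") (simp_all add: g_def abs_mult abs_sgn_eq powr_powr powr_divide)
  have "f x * g x = N * (\<bar>f x\<bar> powr p / N powr p)" for x
  proof -
    have "f x * g x = N * ((\<bar>f x\<bar> / N) * (\<bar>f x\<bar> / N) powr (p - 1))"
      using \<open>0 < N\<close> by (simp add: g_def abs_sgn)
    also have "\<dots> = N * (\<bar>f x\<bar> / N) powr p"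
      using \<open>0 < N\<close> powr_mult_base[of "\<bar>f x\<bar> / N" "p - 1"] by simp
    finally show ?thesis
      using \<open>0 < N\<close> by (simp add: powr_divide)
  qed
  then show "pairing M f g = Lr_norm p M f"
    using I \<open>0 < N\<close> by (simp add: pairing_def flip: N_def)
  have "g \<in> borel_measurable M"
    unfolding g_def by measurable
  then show "g \<in> Lr_unit_sphere q M"
    using int I \<open>0 < N\<close> by (simp add: Lr_unit_sphere_def Lr_space_def Lr_norm_def g_powr)
qed

lemma SUP_pairing_Lr_unit_sphere:
  assumes "1 < p" and "1 < q" and "1 / p + 1 / q = 1"
    and "f \<in> Lr_space p M" and "0 < Lr_norm p M f"
  shows "(SUP g\<in>Lr_unit_sphere q M. ereal (pairing M f g)) = ereal (Lr_norm p M f)"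
proof (rule antisym)
  show "(SUP g\<in>Lr_unit_sphere q M. ereal (pairing M f g)) \<le> ereal (Lr_norm p M f)"
    using pairing_le_Lr_norm[OF assms] by (intro SUP_least) simp
  obtain g where "g \<in> Lr_unit_sphere q M" and "pairing M f g = Lr_norm p M f"
    using Lr_norm_pairing_attained[OF assms] .
  then show "ereal (Lr_norm p M f) \<le> (SUP g\<in>Lr_unit_sphere q M. ereal (pairing M f g))"
    by (metis SUP_upper)
qed

theorem mainTheorem1:
  fixes M :: "'a measure" and p q :: real and \<rho> :: "'a \<Rightarrow> real"
  assumes "1 < p" and "1 < q" and "1 / p + 1 / q = 1"
    and "\<rho> \<in> borel_measurable M"
    and "AE x in M. 0 \<le> \<rho> x"
    and "integrable M \<rho>" and "(\<integral>x. \<rho> x \<partial>M) = 1"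
    and "integrable M (\<lambda>x. \<rho> x powr p)"
  shows "ereal (renyi_entropy p M \<rho>) =
           ereal (p / (1 - p)) * ereal_ln (SUP \<rho>'\<in>Lr_unit_sphere q M. ereal (pairing M \<rho> \<rho>'))
       \<and> ereal (renyi_entropy p M \<rho>) =
           ereal (p / (1 - p)) * ereal_ln (SUP \<rho>'\<in>zero_entropy_set q M. ereal (pairing M \<rho> \<rho>'))"
proof -
  have [measurable]: "\<rho> \<in> borel_measurable M"
    by fact
  \<comment> \<open>The density is nonnegative only almost everywhere, so the powers with and
    without the absolute value agree only up to a null set.\<close>
  have "integrable M (\<lambda>x. \<bar>\<rho> x\<bar> powr p)"
    using assms(5) by (intro integrable_cong_AE_imp[OF assms(8)]) auto
  then have \<rho>: "\<rho> \<in> Lr_space p M"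
    by (simp add: Lr_space_def)
  \<comment> \<open>A function of total mass 1 cannot vanish almost everywhere. Its norm is
    therefore a positive real, and \<open>ereal_ln\<close> takes its finite branch there.\<close>
  have "\<not> (AE x in M. \<rho> x = 0)"
    using integral_eq_zero_AE[of \<rho> M] assms(7) by auto
  then have pos: "0 < Lr_norm p M \<rho>"
    using Lr_norm_pos_iff[OF \<rho>] by simp
  then have "ereal (renyi_entropy p M \<rho>) = ereal (p / (1 - p)) * ereal_ln (ereal (Lr_norm p M \<rho>))"
    using \<open>1 < p\<close> by (simp add: ereal_ln_def renyi_entropy_eq_norm)
  then show ?thesis
    by (simp add: SUP_pairing_Lr_unit_sphere[OF assms(1-3) \<rho> pos]
        zero_entropy_set_eq_Lr_unit_sphere[OF \<open>1 < q\<close>])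
qed

end
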